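(* Let $n\in\mathbb{N}$ and let $\mathbf{k}$ be a commutative ring. Let $i\in[n-2]$. Then, in $\mathbf{k}[S_n]$, $$t_{i+2}\,(t_i-1)=(t_i-1)\,(t_{i+1}-1).$$
   Context: Here $\mathbb{N}=\{0,1,2,\ldots\}$, and $[m]:=\{1,2,\ldots,m\}$ (empty if $m\leq 0$). $S_n$ is the symmetric group on $[n]$, with product $(\pi\sigma)(i)=\pi(\sigma(i))$, viewed as a subset of the group algebra $\mathbf{k}[S_n]$. For distinct $i_1,\ldots,i_k\in[n]$, $\operatorname{cyc}_{i_1,\ldots,i_k}\in S_n$ is the cycle sending $i_1\mapsto i_2\mapsto\cdots\mapsto i_k\mapsto i_1$ and fixing all other elements (so $\operatorname{cyc}_i=\operatorname{id}=1$). For each $\ell\in[n]$, the somewhere-to-below shuffle is $t_\ell:=\operatorname{cyc}_{\ell}+\operatorname{cyc}_{\ell,\ell+1}+\operatorname{cyc}_{\ell,\ell+1,\ell+2}+\cdots+\operatorname{cyc}_{\ell,\ell+1,\ldots,n}\in\mathbf{k}[S_n]$. *)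

theory Defs
  imports "HOL-Algebra.Ring" "HOL-Algebra.Sym_Groups"
begin

text \<open>
  The group algebra of a \<^emph>\<open>finite\<close> group \<open>G\<close> over a ring \<open>R\<close>. Since \<open>G\<close> is finite, no
  finite-support condition is needed. The functions are undefined outside the carrier of \<open>G\<close>,
  so that HOL equality is equality in the algebra. As \<^locale>\<open>cring\<close> does not require
  \<open>\<one> \<noteq> \<zero>\<close>, the zero ring is a legitimate \<open>R\<close>.
\<close>

definition group_algebra ::
    "('a, 'm) ring_scheme \<Rightarrow> ('g, 'n) monoid_scheme \<Rightarrow> ('g \<Rightarrow> 'a) ring"
  where "group_algebra R G =
    \<lparr> carrier = carrier G \<rightarrow>\<^sub>E carrier R,
      monoid.mult = (\<lambda>f g. \<lambda>x\<in>carrier G. \<Oplus>\<^bsub>R\<^esub>y\<in>carrier G. f y \<otimes>\<^bsub>R\<^esub> g (inv\<^bsub>G\<^esub> y \<otimes>\<^bsub>G\<^esub> x)),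
      one = (\<lambda>x\<in>carrier G. if x = \<one>\<^bsub>G\<^esub> then \<one>\<^bsub>R\<^esub> else \<zero>\<^bsub>R\<^esub>),
      zero = (\<lambda>x\<in>carrier G. \<zero>\<^bsub>R\<^esub>),
      add = (\<lambda>f g. \<lambda>x\<in>carrier G. f x \<oplus>\<^bsub>R\<^esub> g x) \<rparr>"

definition group_algebra_of ::
    "('a, 'm) ring_scheme \<Rightarrow> ('g, 'n) monoid_scheme \<Rightarrow> 'g \<Rightarrow> 'g \<Rightarrow> 'a"
  where "group_algebra_of R G g = (\<lambda>x\<in>carrier G. if x = g then \<one>\<^bsub>R\<^esub> else \<zero>\<^bsub>R\<^esub>)"

lemma finsum_swap:
  fixes R (structure)
  assumes "abelian_monoid R" "finite A" "finite B"
    "\<And>a b. a \<in> A \<Longrightarrow> b \<in> B \<Longrightarrow> f a b \<in> carrier R"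
  shows "(\<Oplus>a\<in>A. \<Oplus>b\<in>B. f a b) = (\<Oplus>b\<in>B. \<Oplus>a\<in>A. f a b)"
proof -
  interpret abelian_monoid R by fact
  show ?thesis
    using assms(2,4)
  proof (induction A rule: finite_induct)
    case empty
    then show ?case by simp
  next
    case (insert x A)
    have "(\<Oplus>b\<in>B. f x b \<oplus> (\<Oplus>a\<in>A. f a b)) = (\<Oplus>b\<in>B. f x b) \<oplus> (\<Oplus>b\<in>B. \<Oplus>a\<in>A. f a b)"
      using insert by (intro finsum_addf) (auto intro!: finsum_closed)
    moreover have "(\<Oplus>b\<in>B. \<Oplus>a\<in>insert x A. f a b) = (\<Oplus>b\<in>B. f x b \<oplus> (\<Oplus>a\<in>A. f a b))"
      using insert by (intro finsum_cong') (auto intro!: finsum_closed finsum_insert)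
    moreover have "(\<Oplus>a\<in>insert x A. \<Oplus>b\<in>B. f a b) = (\<Oplus>b\<in>B. f x b) \<oplus> (\<Oplus>a\<in>A. \<Oplus>b\<in>B. f a b)"
      using insert by (intro finsum_insert) (auto intro!: finsum_closed)
    moreover have "(\<Oplus>a\<in>A. \<Oplus>b\<in>B. f a b) = (\<Oplus>b\<in>B. \<Oplus>a\<in>A. f a b)"
      using insert by auto
    ultimately show ?case by simp
  qed
qed

lemma finsum_group_translate:
  assumes "abelian_monoid R" "group G" "z \<in> carrier G" "h \<in> carrier G \<rightarrow> carrier R"
  shows "(\<Oplus>\<^bsub>R\<^esub>y\<in>carrier G. h y) = (\<Oplus>\<^bsub>R\<^esub>y\<in>carrier G. h (z \<otimes>\<^bsub>G\<^esub> y))"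
proof -
  interpret R: abelian_monoid R by fact
  interpret G: group G by fact
  have img: "(\<lambda>y. z \<otimes>\<^bsub>G\<^esub> y) ` carrier G = carrier G"
    using assms(3) by (rule G.surj_const_mult)
  have inj: "inj_on (\<lambda>y. z \<otimes>\<^bsub>G\<^esub> y) (carrier G)"
    using assms(3) by (rule G.inj_on_cmult)
  show ?thesis
    using R.finsum_reindex[OF _ inj, of h] assms(4) by (simp add: img)
qed

lemma group_algebra_ring:
  assumes "ring R" "group G" "finite (carrier G)"
  shows "ring (group_algebra R G)"
proof -
  interpret R: ring R by fact
  interpret G: group G by fact
  let ?A = "group_algebra R G"
  have sum_closed: "(\<Oplus>\<^bsub>R\<^esub>y\<in>carrier G. f y \<otimes>\<^bsub>R\<^esub> g (inv\<^bsub>G\<^esub> y \<otimes>\<^bsub>G\<^esub> x)) \<in> carrier R"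
    if "f \<in> carrier G \<rightarrow> carrier R" "g \<in> carrier G \<rightarrow> carrier R" "x \<in> carrier G" for f g x
    using that by (intro R.finsum_closed) (auto simp: Pi_def)
  have clD: "f y \<in> carrier R" if "f \<in> carrier ?A" "y \<in> carrier G" for f y
    using that by (auto simp: group_algebra_def)
  have res: "restrict f (carrier G) = f" if "f \<in> carrier ?A" for f
    using that unfolding group_algebra_def by (simp add: PiE_restrict)
  have plus: "f \<oplus>\<^bsub>?A\<^esub> g = (\<lambda>x\<in>carrier G. f x \<oplus>\<^bsub>R\<^esub> g x)" for f g
    by (simp add: group_algebra_def)
  have times: "f \<otimes>\<^bsub>?A\<^esub> g =
      (\<lambda>x\<in>carrier G. \<Oplus>\<^bsub>R\<^esub>y\<in>carrier G. f y \<otimes>\<^bsub>R\<^esub> g (inv\<^bsub>G\<^esub> y \<otimes>\<^bsub>G\<^esub> x))" for f g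
    by (simp add: group_algebra_def)
  have zero: "\<zero>\<^bsub>?A\<^esub> = (\<lambda>x\<in>carrier G. \<zero>\<^bsub>R\<^esub>)"
    by (simp add: group_algebra_def)
  have one: "\<one>\<^bsub>?A\<^esub> = (\<lambda>x\<in>carrier G. if x = \<one>\<^bsub>G\<^esub> then \<one>\<^bsub>R\<^esub> else \<zero>\<^bsub>R\<^esub>)"
    by (simp add: group_algebra_def)
  show ?thesis
  proof (rule ringI)
    show "abelian_group ?A"
    proof (rule abelian_groupI)
      fix f assume f: "f \<in> carrier ?A"
      let ?g = "\<lambda>x\<in>carrier G. \<ominus>\<^bsub>R\<^esub> f x"
      have "?g \<in> carrier ?A"
        using clD[OF f] by (simp add: group_algebra_def)
      moreover have "?g \<oplus>\<^bsub>?A\<^esub> f = \<zero>\<^bsub>?A\<^esub>"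
        unfolding plus zero by (rule restrict_ext) (simp add: clD[OF f] R.l_neg)
      ultimately show "\<exists>g\<in>carrier ?A. g \<oplus>\<^bsub>?A\<^esub> f = \<zero>\<^bsub>?A\<^esub>" by blast
      have "\<zero>\<^bsub>?A\<^esub> \<oplus>\<^bsub>?A\<^esub> f = restrict f (carrier G)"
        unfolding plus zero by (rule restrict_ext) (simp add: clD[OF f])
      then show "\<zero>\<^bsub>?A\<^esub> \<oplus>\<^bsub>?A\<^esub> f = f"
        by (simp add: res[OF f])
      fix g assume g: "g \<in> carrier ?A"
      show "f \<oplus>\<^bsub>?A\<^esub> g \<in> carrier ?A"
        using clD[OF f] clD[OF g] by (simp add: group_algebra_def)
      show "f \<oplus>\<^bsub>?A\<^esub> g = g \<oplus>\<^bsub>?A\<^esub> f"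
        unfolding plus by (rule restrict_ext) (simp add: clD[OF f] clD[OF g] R.a_comm)
      fix h assume h: "h \<in> carrier ?A"
      show "f \<oplus>\<^bsub>?A\<^esub> g \<oplus>\<^bsub>?A\<^esub> h = f \<oplus>\<^bsub>?A\<^esub> (g \<oplus>\<^bsub>?A\<^esub> h)"
        unfolding plus by (rule restrict_ext) (simp add: clD[OF f] clD[OF g] clD[OF h] R.a_assoc)
    next
      show "\<zero>\<^bsub>?A\<^esub> \<in> carrier ?A"
        by (simp add: group_algebra_def)
    qed
    show "monoid ?A"
    proof (rule monoidI)
      fix f g assume f: "f \<in> carrier ?A" and g: "g \<in> carrier ?A"
      show "f \<otimes>\<^bsub>?A\<^esub> g \<in> carrier ?A"
        using sum_closed[of f g] clD[OF f] clD[OF g] by (simp add: group_algebra_def)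
      fix h assume h: "h \<in> carrier ?A"
      note fghG = clD[OF f] clD[OF g] clD[OF h]
      have "(\<Oplus>\<^bsub>R\<^esub>y\<in>carrier G. (\<Oplus>\<^bsub>R\<^esub>z\<in>carrier G. f z \<otimes>\<^bsub>R\<^esub> g (inv\<^bsub>G\<^esub> z \<otimes>\<^bsub>G\<^esub> y)) \<otimes>\<^bsub>R\<^esub> h (inv\<^bsub>G\<^esub> y \<otimes>\<^bsub>G\<^esub> x))
          = (\<Oplus>\<^bsub>R\<^esub>z\<in>carrier G. f z \<otimes>\<^bsub>R\<^esub>
              (\<Oplus>\<^bsub>R\<^esub>y\<in>carrier G. g y \<otimes>\<^bsub>R\<^esub> h (inv\<^bsub>G\<^esub> y \<otimes>\<^bsub>G\<^esub> (inv\<^bsub>G\<^esub> z \<otimes>\<^bsub>G\<^esub> x))))"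
        (is "?l = ?r") if x: "x \<in> carrier G" for x
      proof -
        let ?t = "\<lambda>y z. f z \<otimes>\<^bsub>R\<^esub> (g (inv\<^bsub>G\<^esub> z \<otimes>\<^bsub>G\<^esub> y) \<otimes>\<^bsub>R\<^esub> h (inv\<^bsub>G\<^esub> y \<otimes>\<^bsub>G\<^esub> x))"
        have "?l = (\<Oplus>\<^bsub>R\<^esub>y\<in>carrier G. \<Oplus>\<^bsub>R\<^esub>z\<in>carrier G. ?t y z)"
        proof (intro R.finsum_cong' refl)
          fix y assume y: "y \<in> carrier G"
          have "(\<Oplus>\<^bsub>R\<^esub>z\<in>carrier G. f z \<otimes>\<^bsub>R\<^esub> g (inv\<^bsub>G\<^esub> z \<otimes>\<^bsub>G\<^esub> y)) \<otimes>\<^bsub>R\<^esub> h (inv\<^bsub>G\<^esub> y \<otimes>\<^bsub>G\<^esub> x)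
            = (\<Oplus>\<^bsub>R\<^esub>z\<in>carrier G. f z \<otimes>\<^bsub>R\<^esub> g (inv\<^bsub>G\<^esub> z \<otimes>\<^bsub>G\<^esub> y) \<otimes>\<^bsub>R\<^esub> h (inv\<^bsub>G\<^esub> y \<otimes>\<^bsub>G\<^esub> x))"
            using assms(3) x y fghG by (intro R.finsum_ldistr) auto
          also have "\<dots> = (\<Oplus>\<^bsub>R\<^esub>z\<in>carrier G. ?t y z)"
            using x y fghG by (intro R.finsum_cong') (auto simp: R.m_assoc)
          finally show "(\<Oplus>\<^bsub>R\<^esub>z\<in>carrier G. f z \<otimes>\<^bsub>R\<^esub> g (inv\<^bsub>G\<^esub> z \<otimes>\<^bsub>G\<^esub> y)) \<otimes>\<^bsub>R\<^esub> h (inv\<^bsub>G\<^esub> y \<otimes>\<^bsub>G\<^esub> x)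
            = (\<Oplus>\<^bsub>R\<^esub>z\<in>carrier G. ?t y z)" .
        qed (use x fghG in \<open>auto intro!: R.finsum_closed\<close>)
        also have "\<dots> = (\<Oplus>\<^bsub>R\<^esub>z\<in>carrier G. \<Oplus>\<^bsub>R\<^esub>y\<in>carrier G. ?t y z)"
          using x fghG assms(3) by (intro finsum_swap R.abelian_monoid_axioms) auto
        also have "\<dots> = ?r"
        proof (intro R.finsum_cong' refl)
          fix z assume z: "z \<in> carrier G"
          have "(\<Oplus>\<^bsub>R\<^esub>y\<in>carrier G. ?t y z) = (\<Oplus>\<^bsub>R\<^esub>y\<in>carrier G. ?t (z \<otimes>\<^bsub>G\<^esub> y) z)"
            using x z fghG
            by (intro finsum_group_translate R.abelian_monoid_axioms G.group_axioms) auto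
          also have "\<dots> = (\<Oplus>\<^bsub>R\<^esub>y\<in>carrier G. f z \<otimes>\<^bsub>R\<^esub>
              (g y \<otimes>\<^bsub>R\<^esub> h (inv\<^bsub>G\<^esub> y \<otimes>\<^bsub>G\<^esub> (inv\<^bsub>G\<^esub> z \<otimes>\<^bsub>G\<^esub> x))))"
            using x z fghG by (intro R.finsum_cong')
              (auto simp: G.inv_mult_group G.m_assoc G.inv_solve_left' simp flip: G.m_assoc)
          also have "\<dots> = f z \<otimes>\<^bsub>R\<^esub>
              (\<Oplus>\<^bsub>R\<^esub>y\<in>carrier G. g y \<otimes>\<^bsub>R\<^esub> h (inv\<^bsub>G\<^esub> y \<otimes>\<^bsub>G\<^esub> (inv\<^bsub>G\<^esub> z \<otimes>\<^bsub>G\<^esub> x)))"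
            using assms(3) x z fghG by (intro R.finsum_rdistr[symmetric]) auto
          finally show "(\<Oplus>\<^bsub>R\<^esub>y\<in>carrier G. ?t y z) = \<dots>" .
        qed (use x fghG in \<open>auto intro!: R.finsum_closed\<close>)
        finally show ?thesis .
      qed
      moreover have "f \<otimes>\<^bsub>?A\<^esub> g \<otimes>\<^bsub>?A\<^esub> h = (\<lambda>x\<in>carrier G. \<Oplus>\<^bsub>R\<^esub>y\<in>carrier G.
          (\<Oplus>\<^bsub>R\<^esub>z\<in>carrier G. f z \<otimes>\<^bsub>R\<^esub> g (inv\<^bsub>G\<^esub> z \<otimes>\<^bsub>G\<^esub> y)) \<otimes>\<^bsub>R\<^esub> h (inv\<^bsub>G\<^esub> y \<otimes>\<^bsub>G\<^esub> x))"
        unfolding times using fghG sum_closed[of f g]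
        by (intro restrict_ext R.finsum_cong' refl) auto
      moreover have "f \<otimes>\<^bsub>?A\<^esub> (g \<otimes>\<^bsub>?A\<^esub> h) = (\<lambda>x\<in>carrier G. \<Oplus>\<^bsub>R\<^esub>z\<in>carrier G. f z \<otimes>\<^bsub>R\<^esub>
          (\<Oplus>\<^bsub>R\<^esub>y\<in>carrier G. g y \<otimes>\<^bsub>R\<^esub> h (inv\<^bsub>G\<^esub> y \<otimes>\<^bsub>G\<^esub> (inv\<^bsub>G\<^esub> z \<otimes>\<^bsub>G\<^esub> x))))"
        unfolding times using fghG sum_closed[of g h]
        by (intro restrict_ext R.finsum_cong' refl) auto
      ultimately show "f \<otimes>\<^bsub>?A\<^esub> g \<otimes>\<^bsub>?A\<^esub> h = f \<otimes>\<^bsub>?A\<^esub> (g \<otimes>\<^bsub>?A\<^esub> h)"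
        by (simp cong: restrict_cong)
    next
      show "\<one>\<^bsub>?A\<^esub> \<in> carrier ?A"
        by (auto simp: group_algebra_def)
    next
      fix f assume f: "f \<in> carrier ?A"
      note fG = clD[OF f]
      have "(\<Oplus>\<^bsub>R\<^esub>y\<in>carrier G. (if y = \<one>\<^bsub>G\<^esub> then \<one>\<^bsub>R\<^esub> else \<zero>\<^bsub>R\<^esub>) \<otimes>\<^bsub>R\<^esub> f (inv\<^bsub>G\<^esub> y \<otimes>\<^bsub>G\<^esub> x)) = f x"
        if x: "x \<in> carrier G" for x
      proof -
        have "(\<Oplus>\<^bsub>R\<^esub>y\<in>carrier G. (if y = \<one>\<^bsub>G\<^esub> then \<one>\<^bsub>R\<^esub> else \<zero>\<^bsub>R\<^esub>) \<otimes>\<^bsub>R\<^esub> f (inv\<^bsub>G\<^esub> y \<otimes>\<^bsub>G\<^esub> x))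
            = (\<Oplus>\<^bsub>R\<^esub>y\<in>carrier G. if \<one>\<^bsub>G\<^esub> = y then f (inv\<^bsub>G\<^esub> y \<otimes>\<^bsub>G\<^esub> x) else \<zero>\<^bsub>R\<^esub>)"
          using fG x by (intro R.finsum_cong') auto
        also have "\<dots> = f x"
          using R.finsum_singleton[of "\<one>\<^bsub>G\<^esub>" "carrier G" "\<lambda>y. f (inv\<^bsub>G\<^esub> y \<otimes>\<^bsub>G\<^esub> x)"] fG x assms(3)
          by simp
        finally show ?thesis .
      qed
      moreover have "\<one>\<^bsub>?A\<^esub> \<otimes>\<^bsub>?A\<^esub> f = (\<lambda>x\<in>carrier G. \<Oplus>\<^bsub>R\<^esub>y\<in>carrier G.
          (if y = \<one>\<^bsub>G\<^esub> then \<one>\<^bsub>R\<^esub> else \<zero>\<^bsub>R\<^esub>) \<otimes>\<^bsub>R\<^esub> f (inv\<^bsub>G\<^esub> y \<otimes>\<^bsub>G\<^esub> x))"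
        unfolding times one using fG
        by (intro restrict_ext R.finsum_cong' refl) auto
      ultimately show "\<one>\<^bsub>?A\<^esub> \<otimes>\<^bsub>?A\<^esub> f = f"
        using res[OF f] by (simp cong: restrict_cong)
      have "(\<Oplus>\<^bsub>R\<^esub>y\<in>carrier G. f y \<otimes>\<^bsub>R\<^esub> (if inv\<^bsub>G\<^esub> y \<otimes>\<^bsub>G\<^esub> x = \<one>\<^bsub>G\<^esub> then \<one>\<^bsub>R\<^esub> else \<zero>\<^bsub>R\<^esub>)) = f x"
        if x: "x \<in> carrier G" for x
      proof -
        have eq: "inv\<^bsub>G\<^esub> y \<otimes>\<^bsub>G\<^esub> x = \<one>\<^bsub>G\<^esub> \<longleftrightarrow> x = y" if "y \<in> carrier G" for y
          using that x G.inv_solve_left'[of "\<one>\<^bsub>G\<^esub>" y x] by (auto simp: G.l_inv)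
        have "(\<Oplus>\<^bsub>R\<^esub>y\<in>carrier G. f y \<otimes>\<^bsub>R\<^esub> (if inv\<^bsub>G\<^esub> y \<otimes>\<^bsub>G\<^esub> x = \<one>\<^bsub>G\<^esub> then \<one>\<^bsub>R\<^esub> else \<zero>\<^bsub>R\<^esub>))
            = (\<Oplus>\<^bsub>R\<^esub>y\<in>carrier G. if x = y then f y else \<zero>\<^bsub>R\<^esub>)"
          using fG x by (intro R.finsum_cong') (auto simp: eq)
        also have "\<dots> = f x"
          using R.finsum_singleton[of x "carrier G" f] fG x assms(3) by simp
        finally show ?thesis .
      qed
      moreover have "f \<otimes>\<^bsub>?A\<^esub> \<one>\<^bsub>?A\<^esub> = (\<lambda>x\<in>carrier G. \<Oplus>\<^bsub>R\<^esub>y\<in>carrier G.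
          f y \<otimes>\<^bsub>R\<^esub> (if inv\<^bsub>G\<^esub> y \<otimes>\<^bsub>G\<^esub> x = \<one>\<^bsub>G\<^esub> then \<one>\<^bsub>R\<^esub> else \<zero>\<^bsub>R\<^esub>))"
        unfolding times one using fG
        by (intro restrict_ext R.finsum_cong' refl) auto
      ultimately show "f \<otimes>\<^bsub>?A\<^esub> \<one>\<^bsub>?A\<^esub> = f"
        using res[OF f] by (simp cong: restrict_cong)
    qed
  next
    fix f g h assume f: "f \<in> carrier ?A" and g: "g \<in> carrier ?A" and h: "h \<in> carrier ?A"
    note fghG = clD[OF f] clD[OF g] clD[OF h]
    have "(\<Oplus>\<^bsub>R\<^esub>y\<in>carrier G. (f y \<oplus>\<^bsub>R\<^esub> g y) \<otimes>\<^bsub>R\<^esub> h (inv\<^bsub>G\<^esub> y \<otimes>\<^bsub>G\<^esub> x)) =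
        (\<Oplus>\<^bsub>R\<^esub>y\<in>carrier G. f y \<otimes>\<^bsub>R\<^esub> h (inv\<^bsub>G\<^esub> y \<otimes>\<^bsub>G\<^esub> x)) \<oplus>\<^bsub>R\<^esub>
        (\<Oplus>\<^bsub>R\<^esub>y\<in>carrier G. g y \<otimes>\<^bsub>R\<^esub> h (inv\<^bsub>G\<^esub> y \<otimes>\<^bsub>G\<^esub> x))"
        (is "?s = _") if "x \<in> carrier G" for x
    proof (rule trans)
      show "?s = (\<Oplus>\<^bsub>R\<^esub>y\<in>carrier G. f y \<otimes>\<^bsub>R\<^esub> h (inv\<^bsub>G\<^esub> y \<otimes>\<^bsub>G\<^esub> x) \<oplus>\<^bsub>R\<^esub> g y \<otimes>\<^bsub>R\<^esub> h (inv\<^bsub>G\<^esub> y \<otimes>\<^bsub>G\<^esub> x))"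
        using that fghG by (intro R.finsum_cong' refl) (auto simp: R.l_distr)
    qed (use that fghG in \<open>intro R.finsum_addf; auto\<close>)
    moreover have "(f \<oplus>\<^bsub>?A\<^esub> g) \<otimes>\<^bsub>?A\<^esub> h = (\<lambda>x\<in>carrier G. \<Oplus>\<^bsub>R\<^esub>y\<in>carrier G.
        (f y \<oplus>\<^bsub>R\<^esub> g y) \<otimes>\<^bsub>R\<^esub> h (inv\<^bsub>G\<^esub> y \<otimes>\<^bsub>G\<^esub> x))"
      unfolding times plus using fghG
      by (intro restrict_ext R.finsum_cong' refl) auto
    ultimately show "(f \<oplus>\<^bsub>?A\<^esub> g) \<otimes>\<^bsub>?A\<^esub> h = f \<otimes>\<^bsub>?A\<^esub> h \<oplus>\<^bsub>?A\<^esub> g \<otimes>\<^bsub>?A\<^esub> h"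
      by (simp add: times plus cong: restrict_cong)
    have "(\<Oplus>\<^bsub>R\<^esub>y\<in>carrier G. h y \<otimes>\<^bsub>R\<^esub> (f (inv\<^bsub>G\<^esub> y \<otimes>\<^bsub>G\<^esub> x) \<oplus>\<^bsub>R\<^esub> g (inv\<^bsub>G\<^esub> y \<otimes>\<^bsub>G\<^esub> x))) =
        (\<Oplus>\<^bsub>R\<^esub>y\<in>carrier G. h y \<otimes>\<^bsub>R\<^esub> f (inv\<^bsub>G\<^esub> y \<otimes>\<^bsub>G\<^esub> x)) \<oplus>\<^bsub>R\<^esub>
        (\<Oplus>\<^bsub>R\<^esub>y\<in>carrier G. h y \<otimes>\<^bsub>R\<^esub> g (inv\<^bsub>G\<^esub> y \<otimes>\<^bsub>G\<^esub> x))"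
        (is "?s = _") if "x \<in> carrier G" for x
    proof (rule trans)
      show "?s = (\<Oplus>\<^bsub>R\<^esub>y\<in>carrier G. h y \<otimes>\<^bsub>R\<^esub> f (inv\<^bsub>G\<^esub> y \<otimes>\<^bsub>G\<^esub> x) \<oplus>\<^bsub>R\<^esub> h y \<otimes>\<^bsub>R\<^esub> g (inv\<^bsub>G\<^esub> y \<otimes>\<^bsub>G\<^esub> x))"
        using that fghG by (intro R.finsum_cong' refl) (auto simp: R.r_distr)
    qed (use that fghG in \<open>intro R.finsum_addf; auto\<close>)
    moreover have "h \<otimes>\<^bsub>?A\<^esub> (f \<oplus>\<^bsub>?A\<^esub> g) = (\<lambda>x\<in>carrier G. \<Oplus>\<^bsub>R\<^esub>y\<in>carrier G.
        h y \<otimes>\<^bsub>R\<^esub> (f (inv\<^bsub>G\<^esub> y \<otimes>\<^bsub>G\<^esub> x) \<oplus>\<^bsub>R\<^esub> g (inv\<^bsub>G\<^esub> y \<otimes>\<^bsub>G\<^esub> x)))"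
      unfolding times plus using fghG
      by (intro restrict_ext R.finsum_cong' refl) auto
    ultimately show "h \<otimes>\<^bsub>?A\<^esub> (f \<oplus>\<^bsub>?A\<^esub> g) = h \<otimes>\<^bsub>?A\<^esub> f \<oplus>\<^bsub>?A\<^esub> h \<otimes>\<^bsub>?A\<^esub> g"
      by (simp add: times plus cong: restrict_cong)
  qed
qed

lemma group_algebra_of_closed:
  assumes "ring R"
  shows "group_algebra_of R G g \<in> carrier (group_algebra R G)"
proof -
  interpret ring R by fact
  show ?thesis by (auto simp: group_algebra_def group_algebra_of_def)
qed

lemma group_algebra_of_one: "group_algebra_of R G \<one>\<^bsub>G\<^esub> = \<one>\<^bsub>group_algebra R G\<^esub>"
  by (simp add: group_algebra_def group_algebra_of_def)

lemma group_algebra_of_mult: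
  assumes "ring R" "group G" "finite (carrier G)" "g \<in> carrier G" "h \<in> carrier G"
  shows "group_algebra_of R G g \<otimes>\<^bsub>group_algebra R G\<^esub> group_algebra_of R G h =
    group_algebra_of R G (g \<otimes>\<^bsub>G\<^esub> h)"
proof -
  interpret R: ring R by fact
  interpret G: group G by fact
  have "(\<Oplus>\<^bsub>R\<^esub>y\<in>carrier G. group_algebra_of R G g y \<otimes>\<^bsub>R\<^esub>
      group_algebra_of R G h (inv\<^bsub>G\<^esub> y \<otimes>\<^bsub>G\<^esub> x)) = group_algebra_of R G (g \<otimes>\<^bsub>G\<^esub> h) x"
    if x: "x \<in> carrier G" for x
  proof -
    have eq: "inv\<^bsub>G\<^esub> g \<otimes>\<^bsub>G\<^esub> x = h \<longleftrightarrow> x = g \<otimes>\<^bsub>G\<^esub> h"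
      using x assms(4,5) G.inv_solve_left'[of h g x] by auto
    have "(\<Oplus>\<^bsub>R\<^esub>y\<in>carrier G. group_algebra_of R G g y \<otimes>\<^bsub>R\<^esub>
        group_algebra_of R G h (inv\<^bsub>G\<^esub> y \<otimes>\<^bsub>G\<^esub> x)) =
      (\<Oplus>\<^bsub>R\<^esub>y\<in>carrier G. if g = y then group_algebra_of R G h (inv\<^bsub>G\<^esub> y \<otimes>\<^bsub>G\<^esub> x) else \<zero>\<^bsub>R\<^esub>)"
      using x by (intro R.finsum_cong') (auto simp: group_algebra_of_def)
    also have "\<dots> = group_algebra_of R G h (inv\<^bsub>G\<^esub> g \<otimes>\<^bsub>G\<^esub> x)"
      using R.finsum_singleton[OF assms(4,3), of "\<lambda>y. group_algebra_of R G h (inv\<^bsub>G\<^esub> y \<otimes>\<^bsub>G\<^esub> x)"] x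
      by (simp add: group_algebra_of_def)
    also have "\<dots> = group_algebra_of R G (g \<otimes>\<^bsub>G\<^esub> h) x"
      using x assms(4,5) eq by (simp add: group_algebra_of_def)
    finally show ?thesis .
  qed
  then show ?thesis
    by (auto simp: group_algebra_def group_algebra_of_def intro!: restrict_ext)
qed

abbreviation sym_group_algebra :: "('a, 'm) ring_scheme \<Rightarrow> nat \<Rightarrow> ((nat \<Rightarrow> nat) \<Rightarrow> 'a) ring"
  where "sym_group_algebra R n \<equiv> group_algebra R (sym_group n)"

lemma sym_group_algebra_ring: "ring R \<Longrightarrow> ring (sym_group_algebra R n)"
  by (rule group_algebra_ring[OF _ sym_group_is_group]) (auto simp: sym_group_def finite_permutations)

text \<open>
  \<^term>\<open>cycle_of_list [l..<Suc j]\<close> is the cycle \<open>l \<mapsto> l + 1 \<mapsto> \<dots> \<mapsto> j \<mapsto> l\<close>, and the identity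
  for \<open>j = l\<close>.
\<close>

definition somewhere_to_below :: "('a, 'm) ring_scheme \<Rightarrow> nat \<Rightarrow> nat \<Rightarrow> (nat \<Rightarrow> nat) \<Rightarrow> 'a"
  where "somewhere_to_below R n l =
    (\<Oplus>\<^bsub>sym_group_algebra R n\<^esub>j\<in>{l..n}.
       group_algebra_of R (sym_group n) (cycle_of_list [l..<Suc j]))"

lemma cycle_of_list_upt_in_sym_group:
  assumes "l \<in> {1..n}" "j \<in> {l..n}"
  shows "cycle_of_list [l..<Suc j] \<in> carrier (sym_group n)"
proof -
  have "set [l..<Suc j] \<subseteq> {1..n}"
    using assms by auto
  then show ?thesis
    unfolding sym_group_carrier by (rule permutes_subset[OF cycle_permutes])
qed

end

theory Submission
  imports Defs
begin

text \<open>
  Write \<open>c l j\<close> for the cycle \<open>l \<mapsto> l + 1 \<mapsto> \<dots> \<mapsto> j \<mapsto> l\<close>. Subtracting \<open>1\<close> from \<open>t\<^sub>i\<close> drops the term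
  \<open>c i i\<close>, so after expanding, the two sides are the sums of \<open>c (i + 2) p \<circ> c i q\<close> over
  \<open>i + 2 \<le> p \<le> n\<close>, \<open>i < q \<le> n\<close>, and of \<open>c i a \<circ> c (i + 1) b\<close> over \<open>i < a \<le> n\<close>, \<open>i + 2 \<le> b \<le> n\<close>.
  These are sums of the same permutations, matched by \<open>(p, q) = (i + 2, b)\<close> if \<open>a = i + 1\<close>,
  \<open>(p, q) = (b, a - 1)\<close> if \<open>i + 2 \<le> a \<le> b\<close>, and \<open>(p, q) = (b + 1, a)\<close> if \<open>b < a\<close>.
\<close>

text \<open>The fibres \<open>{a} \<times> B\<close> partition \<open>A \<times> B\<close>, and each
  inner sum is a sum over one fibre.\<close>

lemma (in abelian_monoid) finsum_cartesian_product:
  assumes "finite A" "finite B" "\<And>a b. a \<in> A \<Longrightarrow> b \<in> B \<Longrightarrow> f a b \<in> carrier G"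
  shows "(\<Oplus>a\<in>A. \<Oplus>b\<in>B. f a b) = finsum G (\<lambda>(a, b). f a b) (A \<times> B)"
proof -
  have "(\<Oplus>b\<in>B. f a b) = finsum G (\<lambda>(a', b). f a' b) ({a} \<times> B)" if "a \<in> A" for a
  proof -
    have "finsum G (\<lambda>(a', b). f a' b) (Pair a ` B) = (\<Oplus>b\<in>B. case (a, b) of (a', b) \<Rightarrow> f a' b)"
      using that assms(3) by (intro finsum_reindex) (auto simp: inj_on_def)
    moreover have "Pair a ` B = {a} \<times> B" by auto
    ultimately show ?thesis by simp
  qed
  then have "(\<Oplus>a\<in>A. \<Oplus>b\<in>B. f a b) = (\<Oplus>a\<in>A. finsum G (\<lambda>(a', b). f a' b) ({a} \<times> B))"
    using assms(3) by (intro finsum_cong') (auto intro!: finsum_closed)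
  also have "\<dots> = finsum G (\<lambda>(a, b). f a b) (\<Union>a\<in>A. {a} \<times> B)"
    using assms
    by (intro add.finprod_UN_disjoint[symmetric]) (auto simp: pairwise_def disjnt_def)
  also have "(\<Union>a\<in>A. {a} \<times> B) = A \<times> B" by auto
  finally show ?thesis .
qed

text \<open>Puts each side of the theorem into the form of one sum over index pairs, so that a
  single bijection can match the two.\<close>

lemma (in ring) finsum_mult_finsum:
  assumes "finite A" "finite B" "f \<in> A \<rightarrow> carrier R" "g \<in> B \<rightarrow> carrier R"
  shows "(\<Oplus>a\<in>A. f a) \<otimes> (\<Oplus>b\<in>B. g b) = finsum R (\<lambda>(a, b). f a \<otimes> g b) (A \<times> B)"
proof -
  have "(\<Oplus>a\<in>A. f a) \<otimes> (\<Oplus>b\<in>B. g b) = (\<Oplus>a\<in>A. f a \<otimes> (\<Oplus>b\<in>B. g b))"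
    using assms by (intro finsum_ldistr) auto
  also have "\<dots> = (\<Oplus>a\<in>A. \<Oplus>b\<in>B. f a \<otimes> g b)"
    using assms by (intro finsum_cong' finsum_rdistr) (auto simp: Pi_def intro!: finsum_closed)
  also have "\<dots> = finsum R (\<lambda>(a, b). f a \<otimes> g b) (A \<times> B)"
    using assms by (intro finsum_cartesian_product) auto
  finally show ?thesis .
qed

text \<open>Downward induction on \<open>l\<close>: the cycle from \<open>l\<close> is
  \<open>transpose l (Suc l)\<close> after the cycle from \<open>Suc l\<close>. The latter fixes
  \<open>l\<close>, which then moves to \<open>Suc l\<close>, and sends \<open>j\<close> to
  \<open>Suc l\<close>, which then moves to \<open>l\<close>.\<close>

lemma cycle_of_list_upt_apply:
  assumes "l \<le> j"
  shows "cycle_of_list [l..<Suc j] x = (if l \<le> x \<and> x < j then Suc x else if x = j then l else x)"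
  using assms
proof (induction l rule: inc_induct)
  case base
  then show ?case by simp
next
  case (step l)
  have "[l..<Suc j] = l # Suc l # [Suc (Suc l)..<Suc j]"
    using step.hyps by (simp add: upt_conv_Cons)
  moreover have "[Suc l..<Suc j] = Suc l # [Suc (Suc l)..<Suc j]"
    using step.hyps by (simp add: upt_conv_Cons)
  ultimately have "cycle_of_list [l..<Suc j] = transpose l (Suc l) \<circ> cycle_of_list [Suc l..<Suc j]"
    by (simp only: cycle_of_list.simps)
  then show ?case
    using step by (auto simp: transpose_def)
qed

text \<open>With all four cycles given by explicit formulas, each case compares piecewise functions
  pointwise. For \<open>a = i + 1\<close> the cycle from \<open>i + 2\<close> to \<open>p\<close> is
  the identity, and the claim is the splitting of the cycle from \<open>i\<close> to
  \<open>b\<close> at \<open>i + 1\<close>.\<close>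

lemma cycle_of_list_upt_comp:
  assumes "i < a" "i + 2 \<le> b"
    and "(p, q) = (if a = i + 1 then (i + 2, b) else if a \<le> b then (b, a - 1) else (b + 1, a))"
  shows "cycle_of_list [i..<Suc a] \<circ> cycle_of_list [i + 1..<Suc b] =
    cycle_of_list [i + 2..<Suc p] \<circ> cycle_of_list [i..<Suc q]"
proof -
  have "i \<le> a" "i + 1 \<le> b" "i + 2 \<le> p" "i \<le> q"
    using assms by (auto split: if_splits)
  note c = this[THEN cycle_of_list_upt_apply]
  \<comment> \<open>Writing \<open>a = q + 1\<close> for \<open>q = a - 1\<close> avoids truncated
    subtraction. In the last case \<open>b < a\<close> already excludes \<open>a = i + 1\<close>,
    since \<open>i + 2 \<le> b\<close>.\<close>
  consider "a = i + 1" "p = i + 2" "q = b" | "i + 2 \<le> a" "a \<le> b" "p = b" "a = q + 1"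
    | "b < a" "p = b + 1" "q = a"
    using assms by (auto split: if_splits)
  then show ?thesis
  proof cases
    case 1
    show ?thesis
      unfolding fun_eq_iff comp_apply c unfolding 1 using assms(1,2) by simp
  next
    case 2
    show ?thesis
      unfolding fun_eq_iff comp_apply c unfolding 2(3,4) using 2 by auto
  next
    case 3
    show ?thesis
      unfolding fun_eq_iff comp_apply c unfolding 3(2,3) using 3 assms(2) by auto
  qed
qed

lemma bij_betw_cycle_indices:
  fixes i n :: nat
  shows "bij_betw
    (\<lambda>(a, b). if a = i + 1 then (i + 2, b) else if a \<le> b then (b, a - 1) else (b + 1, a))
    ({i + 1..n} \<times> {i + 2..n}) ({i + 2..n} \<times> {i + 1..n})"
    (is "bij_betw ?f ?S ?T")
proof (rule bij_betw_byWitness)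
  \<comment> \<open>The image tells which branch of \<open>?f\<close> was used: only the middle one
    gives \<open>q < p\<close>; of the other two, the first gives \<open>p = i + 2\<close> and the
    last \<open>p \<ge> i + 3\<close>.\<close>
  let ?g = "\<lambda>(p, q). if q < p then (q + 1, p) else if p = i + 2 then (i + 1, q) else (q, p - 1)"
  show "\<forall>x\<in>?S. ?g (?f x) = x" "\<forall>y\<in>?T. ?f (?g y) = y"
    by auto
  show "?f ` ?S \<subseteq> ?T" "?g ` ?T \<subseteq> ?S"
    by (auto simp: image_subset_iff)
qed

lemma somewhere_to_below_minus_one:
  assumes "ring k" "l \<in> {1..n}"
  shows "somewhere_to_below k n l \<ominus>\<^bsub>sym_group_algebra k n\<^esub> \<one>\<^bsub>sym_group_algebra k n\<^esub> =
    (\<Oplus>\<^bsub>sym_group_algebra k n\<^esub>j\<in>{l + 1..n}.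
      group_algebra_of k (sym_group n) (cycle_of_list [l..<Suc j]))"
proof -
  interpret A: ring "sym_group_algebra k n"
    by (rule sym_group_algebra_ring) fact
  let ?u = "\<lambda>j. group_algebra_of k (sym_group n) (cycle_of_list [l..<Suc j])"
  have u: "?u j \<in> carrier (sym_group_algebra k n)" for j
    by (rule group_algebra_of_closed) fact
  have "{l..n} = insert l {l + 1..n}"
    using assms(2) by auto
  then have "somewhere_to_below k n l =
      ?u l \<oplus>\<^bsub>sym_group_algebra k n\<^esub> (\<Oplus>\<^bsub>sym_group_algebra k n\<^esub>j\<in>{l + 1..n}. ?u j)"
    unfolding somewhere_to_below_def using u by (simp add: A.finsum_insert del: upt_Suc)
  \<comment> \<open>The cycle of the one-element list \<open>[l]\<close> is the identity
    permutation.\<close>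
  moreover have "?u l = \<one>\<^bsub>sym_group_algebra k n\<^esub>"
    using group_algebra_of_one[of k "sym_group n"] by (simp add: sym_group_one)
  moreover have "(\<Oplus>\<^bsub>sym_group_algebra k n\<^esub>j\<in>{l + 1..n}. ?u j) \<in> carrier (sym_group_algebra k n)"
    using u by (intro A.finsum_closed) auto
  ultimately show ?thesis
    by (simp add: A.minus_eq A.a_ac A.r_neg2 del: upt_Suc)
qed

theorem theorem6p1:
  fixes k :: "('a, 'm) ring_scheme" and n i :: nat
  assumes "cring k" and "i \<in> {1..n - 2}"
  shows
    "somewhere_to_below k n (i + 2)
        \<otimes>\<^bsub>sym_group_algebra k n\<^esub>
      (somewhere_to_below k n i \<ominus>\<^bsub>sym_group_algebra k n\<^esub> \<one>\<^bsub>sym_group_algebra k n\<^esub>) =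
     (somewhere_to_below k n i \<ominus>\<^bsub>sym_group_algebra k n\<^esub> \<one>\<^bsub>sym_group_algebra k n\<^esub>)
        \<otimes>\<^bsub>sym_group_algebra k n\<^esub>
      (somewhere_to_below k n (i + 1) \<ominus>\<^bsub>sym_group_algebra k n\<^esub> \<one>\<^bsub>sym_group_algebra k n\<^esub>)"
proof -
  interpret k: cring k by fact
  let ?A = "sym_group_algebra k n"
  let ?c = "\<lambda>l j. cycle_of_list [l..<Suc j]"
  let ?u = "group_algebra_of k (sym_group n)"
  let ?S = "{i + 1..n} \<times> {i + 2..n}" and ?T = "{i + 2..n} \<times> {i + 1..n}"
  define \<phi> where
    "\<phi> = (\<lambda>(a, b). if a = i + 1 then (i + 2, b) else if a \<le> b then (b, a - 1) else (b + 1, a))"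
  have \<phi>: "bij_betw \<phi> ?S ?T"
    unfolding \<phi>_def by (rule bij_betw_cycle_indices)
  interpret A: ring ?A
    by (rule sym_group_algebra_ring) (rule k.ring_axioms)
  have u: "?u g \<in> carrier ?A" for g
    by (rule group_algebra_of_closed) (rule k.ring_axioms)
  have u_mult: "?u (?c l j) \<otimes>\<^bsub>?A\<^esub> ?u (?c l' j') = ?u (?c l j \<circ> ?c l' j')"
    if "l \<in> {1..n}" "j \<in> {l..n}" "l' \<in> {1..n}" "j' \<in> {l'..n}" for l j l' j'
    using group_algebra_of_mult[OF k.ring_axioms sym_group_is_group, of n "?c l j" "?c l' j'"]
      cycle_of_list_upt_in_sym_group[OF that(1,2)] cycle_of_list_upt_in_sym_group[OF that(3,4)]
    by (simp add: sym_group_mult sym_group_def finite_permutations del: upt_Suc)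
  \<comment> \<open>Membership in \<open>{1..n - 2}\<close> forces \<open>n \<ge> 3\<close>, so the
    subtraction is not truncated.\<close>
  have i: "i \<in> {1..n}" "i + 1 \<in> {1..n}" "i + 2 \<in> {1..n}"
    using assms(2) by auto
  \<comment> \<open>The chain starts from the right-hand side, whose index pairs form the domain of
    \<open>\<phi>\<close>. Dropping the first term of the second factor makes its sum start at
    \<open>(i + 1) + 1 = i + 2\<close>.\<close>
  have "(somewhere_to_below k n i \<ominus>\<^bsub>?A\<^esub> \<one>\<^bsub>?A\<^esub>) \<otimes>\<^bsub>?A\<^esub> (somewhere_to_below k n (i + 1) \<ominus>\<^bsub>?A\<^esub> \<one>\<^bsub>?A\<^esub>) =
      (\<Oplus>\<^bsub>?A\<^esub>a\<in>{i + 1..n}. ?u (?c i a)) \<otimes>\<^bsub>?A\<^esub> (\<Oplus>\<^bsub>?A\<^esub>b\<in>{i + 2..n}. ?u (?c (i + 1) b))"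
    using somewhere_to_below_minus_one[OF k.ring_axioms i(1)]
      somewhere_to_below_minus_one[OF k.ring_axioms i(2)]
    by (simp add: add.assoc del: upt_Suc)
  also have "\<dots> = finsum ?A (\<lambda>(a, b). ?u (?c i a) \<otimes>\<^bsub>?A\<^esub> ?u (?c (i + 1) b)) ?S"
    using u by (intro A.finsum_mult_finsum) auto
  \<comment> \<open>Termwise, both products are the basis element of the same permutation.
    Expressing the summand through \<open>\<phi> x\<close> prepares the reindexing along
    \<open>\<phi>\<close>.\<close>
  also have "\<dots> = (\<Oplus>\<^bsub>?A\<^esub>x\<in>?S. case \<phi> x of (p, q) \<Rightarrow> ?u (?c (i + 2) p) \<otimes>\<^bsub>?A\<^esub> ?u (?c i q))"
  proof (rule A.finsum_cong'[OF refl])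
    fix x assume x: "x \<in> ?S"
    obtain a b where ab: "x = (a, b)" by (cases x)
    obtain p q where pq: "\<phi> x = (p, q)" by (rule prod.exhaust)
    have T: "(p, q) \<in> ?T"
      using bij_betw_apply[OF \<phi> x] unfolding pq .
    have "?c i a \<circ> ?c (i + 1) b = ?c (i + 2) p \<circ> ?c i q"
      using x pq unfolding ab \<phi>_def by (intro cycle_of_list_upt_comp) auto
    moreover have "?u (?c i a) \<otimes>\<^bsub>?A\<^esub> ?u (?c (i + 1) b) = ?u (?c i a \<circ> ?c (i + 1) b)"
      using x i unfolding ab by (intro u_mult) auto
    moreover have "?u (?c (i + 2) p) \<otimes>\<^bsub>?A\<^esub> ?u (?c i q) = ?u (?c (i + 2) p \<circ> ?c i q)"
      using T i by (intro u_mult) auto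
    ultimately show "(case x of (a, b) \<Rightarrow> ?u (?c i a) \<otimes>\<^bsub>?A\<^esub> ?u (?c (i + 1) b)) =
        (case \<phi> x of (p, q) \<Rightarrow> ?u (?c (i + 2) p) \<otimes>\<^bsub>?A\<^esub> ?u (?c i q))"
      unfolding pq unfolding ab by (simp del: upt_Suc)
  qed (use u in \<open>auto simp del: upt_Suc split: prod.split\<close>)
  also have "\<dots> = finsum ?A (\<lambda>(p, q). ?u (?c (i + 2) p) \<otimes>\<^bsub>?A\<^esub> ?u (?c i q)) (\<phi> ` ?S)"
    using u bij_betw_imp_inj_on[OF \<phi>]
    by (intro A.finsum_reindex[symmetric]) auto
  also have "\<phi> ` ?S = ?T"
    by (rule bij_betw_imp_surj_on[OF \<phi>])
  also have "finsum ?A (\<lambda>(p, q). ?u (?c (i + 2) p) \<otimes>\<^bsub>?A\<^esub> ?u (?c i q)) ?T =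
      (\<Oplus>\<^bsub>?A\<^esub>p\<in>{i + 2..n}. ?u (?c (i + 2) p)) \<otimes>\<^bsub>?A\<^esub> (\<Oplus>\<^bsub>?A\<^esub>q\<in>{i + 1..n}. ?u (?c i q))"
    using u by (intro A.finsum_mult_finsum[symmetric]) auto
  also have "\<dots> = somewhere_to_below k n (i + 2) \<otimes>\<^bsub>?A\<^esub> (somewhere_to_below k n i \<ominus>\<^bsub>?A\<^esub> \<one>\<^bsub>?A\<^esub>)"
    unfolding somewhere_to_below_minus_one[OF k.ring_axioms i(1)]
    by (simp only: somewhere_to_below_def)
  finally show ?thesis ..
qed

end
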